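(* Let $s\ge0$ be an integer, $h\in\mathbb C\setminus\{0\}$ and $q\in\mathbb C\setminus\{0\}$. Then $$S_{s,h,q}[n,k]=\sum_{j=k}^nh^{n-j}q^{s(j-1)-(s-1)(k-1)}S_{s,h,q}[j-1,k-1]\prod_{i=j}^{n-1}[si-(s-1)k]_q\qquad(1\le k\le n),$$ $$S_{s,h,q}[n,k]=\sum_{j=k}^n(-h)^{j-k}q^{sn(k-j-1)+(s-1)\binom{j+1}2-(s-1)\binom k2}S_{s,h,q}[n+1,j+1]\prod_{i=k+1}^j[sn-(s-1)i]_q\qquad(0\le k\le n),$$ $$S_{s,h,q}[n,k]=\sum_{j=0}^kh\,q^{j(sn-(s-1)k)-\binom{j+1}2}[s(n-j-1)-(s-1)(k-j)]_q\,S_{s,h,q}[n-j-1,k-j]\qquad(0\le k<n).$$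
   Context: For an integer $x$, $[x]_q=\frac{q^x-1}{q-1}$ if $q\ne1$ and $[x]_1=x$. The numbers $S_{s,h,q}[n,k]$ are the coefficients in $(VU)^n=\sum_{k=0}^nS_{s,h,q}[n,k]V^{sn-(s-1)k}U^k$, where $UV-qVU=hV^s$; equivalently they are determined by $S_{s,h,q}[n,k]=q^{s(n-1)-(s-1)(k-1)}S_{s,h,q}[n-1,k-1]+h[s(n-1)-(s-1)k]_q\,S_{s,h,q}[n-1,k]$ for $n,k\ge1$, with $S_{s,h,q}[n,0]=S_{s,h,q}[0,n]=\delta_{0,n}$. Empty products equal $1$. *)

theory Defs
  imports Complex_Main
begin

(* Negative arguments arise in the recurrence below for s > 1, but only next to vanishing
   coefficients (lower index above the upper one). *)
definition qint :: "complex \<Rightarrow> int \<Rightarrow> complex" where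
  "qint q x = (if q = 1 then of_int x else (q powi x - 1) / (q - 1))"

fun gstirling :: "nat \<Rightarrow> complex \<Rightarrow> complex \<Rightarrow> nat \<Rightarrow> nat \<Rightarrow> complex" where
  "gstirling s h q 0 0 = 1"
| "gstirling s h q 0 (Suc k) = 0"
| "gstirling s h q (Suc n) 0 = 0"
| "gstirling s h q (Suc n) (Suc k) =
     q powi (int s * int n - (int s - 1) * int k) * gstirling s h q n k
     + h * qint q (int s * int n - (int s - 1) * int (Suc k)) * gstirling s h q n (Suc k)"

lemma gstirling_rec:
  assumes "n \<ge> 1" "k \<ge> 1"
  shows "gstirling s h q n k =
           q powi (int s * (int n - 1) - (int s - 1) * (int k - 1)) * gstirling s h q (n - 1) (k - 1)
           + h * qint q (int s * (int n - 1) - (int s - 1) * int k) * gstirling s h q (n - 1) k"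
  using assms by (cases n; cases k) auto

lemma gstirling_0_right: "gstirling s h q n 0 = (if n = 0 then 1 else 0)"
  by (cases n) auto

lemma gstirling_0_left: "gstirling s h q 0 n = (if n = 0 then 1 else 0)"
  by (cases n) auto

lemma gstirling_eq_0: "n < k \<Longrightarrow> gstirling s h q n k = 0"
proof (induction n arbitrary: k)
  case 0
  then show ?case by (cases k) auto
next
  case (Suc n)
  then show ?case by (cases k) auto
qed

text \<open>
  Adequacy of the recurrence: the numbers are exactly the coefficients of \<open>(V U)\<^sup>n\<close> in terms of
  \<open>V\<^bsup>s n - (s - 1) k\<^esup> U\<^sup>k\<close> when \<open>U V - q V U = h V\<^sup>s\<close>. The expansion \<open>normal_ordering\<close> holds in every
  algebra over the complex numbers (with structure map \<open>c\<close>). The coefficients are unique because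
  of the left regular representation \<open>opV\<close>, \<open>opU\<close> (acting on coefficient arrays \<open>f a b\<close> of
  \<open>V\<^sup>a U\<^sup>b\<close>): it satisfies the relation (\<open>op_comm\<close>), sends the monomials, applied to 1, to distinct
  unit vectors (\<open>op_monomial\<close>), and reads off the coefficients (\<open>normal_ordering_op\<close>).
  For \<open>k \<le> n\<close> the exponent \<open>s n - (s - 1) k\<close> is the natural number \<open>s (n - k) + k\<close>.
\<close>

lemma qint_0: "qint q 0 = 0"
  by (simp add: qint_def)

lemma qint_Suc: "qint q (int (Suc m)) = q ^ m + qint q (int m)"
proof (cases "q = 1")
  case True
  then show ?thesis by (simp add: qint_def)
next
  case False
  then show ?thesis
    unfolding qint_def power_int_of_nat by (simp add: field_simps)
qed

lemma qint_Suc': "qint q (int (Suc m)) = 1 + q * qint q (int m)"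
proof (cases "q = 1")
  case True
  then show ?thesis by (simp add: qint_def)
next
  case False
  then show ?thesis
    unfolding qint_def power_int_of_nat by (simp add: field_simps)
qed

lemma exponent_nat:
  assumes "k \<le> n"
  shows "int s * int n - (int s - 1) * int k = int (s * (n - k) + k)"
proof -
  obtain d where "n = k + d" using assms le_Suc_ex by blast
  then show ?thesis by (simp add: algebra_simps)
qed

lemma gstirling_Suc_nat:
  assumes "k \<le> n"
  shows "gstirling s h q (Suc n) (Suc k) =
           q ^ (s * (n - k) + k) * gstirling s h q n k
           + h * qint q (int (s * (n - Suc k) + Suc k)) * gstirling s h q n (Suc k)"
proof (cases "k = n")
  case True
  then show ?thesis
    using exponent_nat[OF assms, of s] by (simp add: gstirling_eq_0 del: of_nat_Suc)
next
  case False
  then have "Suc k \<le> n" using assms by simp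
  then show ?thesis
    using exponent_nat[OF assms, of s] exponent_nat[of "Suc k" n s]
    by (simp del: of_nat_Suc of_nat_add of_nat_mult of_nat_diff add: power_int_of_nat)
qed

lemma normal_ordering:
  fixes c :: "complex \<Rightarrow> 'a::ring_1" and U V :: 'a
  assumes c: "c 1 = 1" "\<And>x y. c (x + y) = c x + c y" "\<And>x y. c (x * y) = c x * c y"
    and central: "\<And>x. c x * U = U * c x" "\<And>x. c x * V = V * c x"
    and comm: "U * V - c q * (V * U) = c h * V ^ s"
  shows "(V * U) ^ n = (\<Sum>k=0..n. c (gstirling s h q n k) * V ^ (s * (n - k) + k) * U ^ k)"
proof -
  have c0: "c 0 = 0" using c(2)[of 0 0] by simp
  have comm': "U * V = c q * (V * U) + c h * V ^ s"
    using comm by (simp add: algebra_simps)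
  have cV: "c x * V ^ m = V ^ m * c x" for x m
    by (induction m) (simp_all add: mult.assoc[symmetric] central, simp add: mult.assoc)
  have VU: "V * U * V ^ m = c (q ^ m) * V ^ Suc m * U + c (h * qint q (int m)) * V ^ (m + s)" for m
  proof (induction m)
    case 0
    then show ?case by (simp add: c c0 qint_0)
  next
    case (Suc m)
    have "V * U * V ^ Suc m = (V * U * V ^ m) * V"
      by (simp only: power_Suc2 mult.assoc)
    also have "\<dots> = c (q ^ m) * V ^ Suc m * (U * V) + c (h * qint q (int m)) * V ^ (m + s) * V"
      unfolding Suc.IH by (simp only: distrib_right mult.assoc)
    also have "\<dots> = c (q ^ m) * (V ^ Suc m * c q) * V * U + c (q ^ m) * (V ^ Suc m * c h) * V ^ s
                     + c (h * qint q (int m)) * V ^ (m + s) * V"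
      by (simp only: comm' distrib_left mult.assoc)
    also have "\<dots> = c (q ^ Suc m) * V ^ Suc (Suc m) * U
                     + (c (h * q ^ m) * V ^ (Suc m + s) + c (h * qint q (int m)) * V ^ (Suc m + s))"
    proof -
      have 1: "c (q ^ m) * (V ^ Suc m * c q) * V * U = c (q ^ Suc m) * V ^ Suc (Suc m) * U"
        by (simp only: cV[symmetric] power_Suc2[of q] power_Suc2[of V "Suc m"] c mult.assoc)
      have 2: "c (q ^ m) * (V ^ Suc m * c h) * V ^ s = c (h * q ^ m) * V ^ (Suc m + s)"
        by (simp only: cV[symmetric] power_add mult.commute[of h] c mult.assoc)
      have 3: "V ^ (m + s) * V = V ^ (Suc m + s)"
        by (simp only: power_Suc2[symmetric] add_Suc)
      show ?thesis unfolding 1 2 by (simp only: mult.assoc 3 add.assoc)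
    qed
    also have "c (h * q ^ m) * V ^ (Suc m + s) + c (h * qint q (int m)) * V ^ (Suc m + s)
               = c (h * qint q (int (Suc m))) * V ^ (Suc m + s)"
      by (simp only: qint_Suc distrib_left c distrib_right)
    finally show ?case .
  qed
  show ?thesis
  proof (induction n)
    case 0
    then show ?case by (simp add: c)
  next
    case (Suc n)
    let ?S = "gstirling s h q"
    let ?a = "\<lambda>k. s * (n - k) + k"
    let ?A = "\<lambda>k. c (q ^ ?a k * ?S n k) * V ^ Suc (?a k) * U ^ Suc k"
    let ?B = "\<lambda>k. c (h * qint q (int (?a k)) * ?S n k) * V ^ (?a k + s) * U ^ k"
    have summand: "V * U * (c (?S n k) * V ^ ?a k * U ^ k) = ?A k + ?B k" for k
    proof -
      have "V * U * (c (?S n k) * V ^ ?a k * U ^ k) = c (?S n k) * (V * U * V ^ ?a k) * U ^ k"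
        using central by (simp flip: mult.assoc) (simp add: mult.assoc)
      also have "\<dots> = ?A k + ?B k"
        unfolding VU by (simp only: mult.commute[of _ "?S n k"] c distrib_left distrib_right mult.assoc
              power_Suc[of U])
      finally show ?thesis .
    qed
    have B0: "?B 0 = 0"
      by (cases n) (simp_all add: c0 qint_0)
    have BSn: "?B (Suc n) = 0"
      by (simp add: gstirling_eq_0 c0)
    have "(V * U) ^ Suc n = V * U * (V * U) ^ n" by simp
    also have "\<dots> = (\<Sum>k=0..n. ?A k) + (\<Sum>k=0..n. ?B k)"
      unfolding Suc.IH sum_distrib_left summand by (rule sum.distrib)
    also have "(\<Sum>k=0..n. ?B k) = (\<Sum>k=0..Suc n. ?B k)"
      by (simp only: sum.atLeast0_atMost_Suc BSn add_0_right)
    also have "\<dots> = (\<Sum>k=0..n. ?B (Suc k))"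
      by (simp only: sum.atLeast0_atMost_Suc_shift B0 add_0_left o_def)
    also have "(\<Sum>k=0..n. ?A k) + (\<Sum>k=0..n. ?B (Suc k))
               = (\<Sum>k=0..n. c (?S (Suc n) (Suc k)) * V ^ (s * (Suc n - Suc k) + Suc k) * U ^ Suc k)"
      unfolding sum.distrib[symmetric]
    proof (rule sum.cong[OF refl])
      fix k assume "k \<in> {0..n}"
      then have k: "k \<le> n" by simp
      have B: "?B (Suc k) = c (h * qint q (int (?a (Suc k))) * ?S n (Suc k)) * V ^ Suc (?a k) * U ^ Suc k"
      proof (cases "k = n")
        case True
        then show ?thesis by (simp add: gstirling_eq_0 c0)
      next
        case False
        then have e: "n - k = Suc (n - Suc k)" using k by simp
        have "?a (Suc k) + s = Suc (?a k)" unfolding e by simp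
        then show ?thesis by (simp only:)
      qed
      have e: "s * (Suc n - Suc k) + Suc k = Suc (?a k)" by simp
      show "?A k + ?B (Suc k)
            = c (?S (Suc n) (Suc k)) * V ^ (s * (Suc n - Suc k) + Suc k) * U ^ Suc k"
        unfolding B e gstirling_Suc_nat[OF k] c(2) distrib_right ..
    qed
    also have "\<dots> = (\<Sum>k=0..Suc n. c (?S (Suc n) k) * V ^ (s * (Suc n - k) + k) * U ^ k)"
      by (subst sum.atLeast0_atMost_Suc_shift) (simp add: c0)
    finally show ?case .
  qed
qed

definition opV :: "(nat \<Rightarrow> nat \<Rightarrow> complex) \<Rightarrow> nat \<Rightarrow> nat \<Rightarrow> complex" where
  "opV f a b = (if a = 0 then 0 else f (a - 1) b)"

definition opU :: "nat \<Rightarrow> complex \<Rightarrow> complex \<Rightarrow> (nat \<Rightarrow> nat \<Rightarrow> complex) \<Rightarrow> nat \<Rightarrow> nat \<Rightarrow> complex" where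
  "opU s h q f a b = (if b = 0 then 0 else q ^ a * f a (b - 1))
     + (if a < s then 0 else h * qint q (int (a - s + 1)) * f (a - s + 1) b)"

definition unit_at :: "nat \<Rightarrow> nat \<Rightarrow> nat \<Rightarrow> nat \<Rightarrow> complex" where
  "unit_at i j a b = (if a = i \<and> b = j then 1 else 0)"

lemma opV_power: "(opV ^^ m) f a b = (if a < m then 0 else f (a - m) b)"
  by (induction m arbitrary: a) (auto simp: opV_def)

lemma op_comm: "opU s h q (opV f) a b - q * opV (opU s h q f) a b = h * (opV ^^ s) f a b"
proof (cases a)
  case 0
  then show ?thesis by (simp add: opV_power opU_def opV_def qint_def)
next
  case (Suc m)
  consider "Suc m < s" | "Suc m = s" | "m \<ge> s" by linarith
  then show ?thesis
  proof cases
    case 1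
    then show ?thesis using Suc by (simp add: opV_power opU_def opV_def)
  next
    case 2
    have "qint q 1 = 1" by (simp add: qint_def)
    then show ?thesis using Suc 2 by (auto simp: opV_power opU_def opV_def)
  next
    case 3
    have e: "Suc m - s = Suc (m - s)" using 3 by simp
    show ?thesis using Suc 3
      by (simp add: opV_power opU_def opV_def e qint_Suc'[of q "Suc (m - s)"] algebra_simps
               del: of_nat_Suc)
  qed
qed

lemma op_monomial: "(opV ^^ i) ((opU s h q ^^ j) (unit_at 0 0)) = unit_at i j"
proof -
  have U: "(opU s h q ^^ j) (unit_at 0 0) = unit_at 0 j"
    by (induction j) (auto simp: opU_def unit_at_def fun_eq_iff)
  show ?thesis unfolding U by (auto simp: fun_eq_iff opV_power unit_at_def)
qed

lemma normal_ordering_op: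
  "((opV \<circ> opU s h q) ^^ n) (unit_at 0 0) a k =
     (if k \<le> n \<and> a = s * (n - k) + k then gstirling s h q n k else 0)"
proof (induction n arbitrary: a k)
  case 0
  then show ?case by (auto simp: unit_at_def)
next
  case (Suc n)
  let ?f = "((opV \<circ> opU s h q) ^^ n) (unit_at 0 0)"
  have step: "((opV \<circ> opU s h q) ^^ Suc n) (unit_at 0 0) a k = opV (opU s h q ?f) a k"
    by simp
  show ?case
  proof (cases a)
    case 0
    then show ?thesis unfolding step by (cases k) (auto simp: opV_def)
  next
    case (Suc m)
    show ?thesis
    proof (cases k)
      case 0
      then show ?thesis
        unfolding step using Suc 0
        by (auto simp: opV_def opU_def Suc.IH gstirling_0_right qint_0 simp del: gstirling.simps)
    next
      case k: (Suc l)
      have val: "opV (opU s h q ?f) (Suc m) (Suc l) = q ^ m * ?f m l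
          + (if m < s then 0 else h * qint q (int (m - s + 1)) * ?f (m - s + 1) (Suc l))"
        by (simp add: opV_def opU_def)
      consider "n < l" | "n = l" | "l < n" by linarith
      then show ?thesis
      proof cases
        case 1
        then show ?thesis unfolding step using Suc k
          by (auto simp: opV_def opU_def Suc.IH)
      next
        case 2
        then show ?thesis using gstirling_Suc_nat[of l n s h q]
          unfolding step unfolding Suc k val Suc.IH using 2
          by (auto simp: gstirling_eq_0 simp del: gstirling.simps)
      next
        case 3
        then obtain d where d: "n = Suc (l + d)" using less_iff_Suc_add by auto
        have iff: "(s \<le> m \<and> m - s + 1 = s * d + Suc l) = (m = s * Suc d + l)" by auto
        have l: "l \<le> n" using 3 by simp
        have [simp]: "n - l = Suc d" "n - Suc l = d" "Suc l \<le> n" "l \<le> n" using d by auto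
        have "opV (opU s h q ?f) a k =
                q ^ m * (if m = s * Suc d + l then gstirling s h q n l else 0)
                + (if s \<le> m \<and> m - s + 1 = s * d + Suc l
                   then h * qint q (int (s * d + Suc l)) * gstirling s h q n (Suc l) else 0)"
          unfolding Suc k val Suc.IH by auto
        also have "\<dots> = (if m = s * Suc d + l then gstirling s h q (Suc n) (Suc l) else 0)"
          unfolding iff gstirling_Suc_nat[OF l] by simp
        finally show ?thesis unfolding step unfolding Suc k using l by (simp del: gstirling.simps)
      qed
    qed
  qed
qed

end

theory Submission
  imports Defs
begin

text \<open>
  Each identity iterates the recurrence for \<open>S[n,k]\<close> in one direction: the first in \<open>n\<close> with \<open>k\<close>
  fixed, the third along the diagonal. The second solves the recurrence for \<open>S[n+1,k+1]\<close> for
  \<open>S[n,k]\<close> and iterates in \<open>k\<close>, downwards from \<open>S[n,n+1] = 0\<close>.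
\<close>

text \<open>A sum of this shape solves the inhomogeneous linear recurrence
  \<open>F (Suc n) = a (Suc n) + h * b n * F n\<close>: every old summand gains the factor
  \<open>h * b n\<close>, and the new one, \<open>j = Suc n\<close>, has an empty product.\<close>

lemma sum_vertical_step:
  fixes a :: "nat \<Rightarrow> 'a::comm_semiring_1"
  assumes "k \<le> n"
  shows "(\<Sum>j=k..Suc n. h ^ (Suc n - j) * a j * (\<Prod>i=j..<Suc n. b i))
       = a (Suc n) + h * b n * (\<Sum>j=k..n. h ^ (n - j) * a j * (\<Prod>i=j..<n. b i))"
proof -
  have "(\<Sum>j=k..n. h ^ (Suc n - j) * a j * (\<Prod>i=j..<Suc n. b i))
      = (\<Sum>j=k..n. h * b n * (h ^ (n - j) * a j * (\<Prod>i=j..<n. b i)))"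
    by (rule sum.cong) (simp_all add: Suc_diff_le mult_ac)
  then show ?thesis
    using assms by (simp add: sum_distrib_left add.commute)
qed

lemma gstirling_vertical:
  assumes "1 \<le> k" "k \<le> n"
  shows "gstirling s h q n k =
    (\<Sum>j=k..n. h ^ (n - j)
       * (q powi (int s * (int j - 1) - (int s - 1) * (int k - 1)) * gstirling s h q (j - 1) (k - 1))
       * (\<Prod>i=j..<n. qint q (int s * int i - (int s - 1) * int k)))"
  using assms(2)
proof (induction n rule: dec_induct)
  case base
  \<comment> \<open>For \<open>n = k\<close> the second term of the recurrence contains S[k-1,k] =
    0.\<close>
  show ?case using assms(1) by (subst gstirling_rec) (simp_all add: gstirling_eq_0)
next
  case (step n)
  have "gstirling s h q (Suc n) k
      = q powi (int s * (int (Suc n) - 1) - (int s - 1) * (int k - 1)) * gstirling s h q (Suc n - 1) (k - 1)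
        + h * qint q (int s * int n - (int s - 1) * int k) * gstirling s h q n k"
    using gstirling_rec[of "Suc n" k s h q] assms(1) by simp
  then show ?case
    unfolding sum_vertical_step[OF step.hyps(1)] step.IH .
qed

text \<open>Since \<open>q\<close> is nonzero, S[n,k] can be isolated in the recurrence for
  S[n+1,k+1]. The exponent in summand \<open>j\<close> collects -(s n - (s-1) i) over i = k..j; the
  terms linear in i add up to the difference of binomials.\<close>

lemma gstirling_horizontal:
  assumes "q \<noteq> 0" "k \<le> n"
  shows "gstirling s h q n k =
    (\<Sum>j=k..n. (- h) ^ (j - k)
       * q powi (int s * int n * (int k - int j - 1)
                 + (int s - 1) * int ((j + 1) choose 2) - (int s - 1) * int (k choose 2))
       * gstirling s h q (n + 1) (j + 1)
       * (\<Prod>i=k+1..j. qint q (int s * int n - (int s - 1) * int i)))"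
  using assms(2)
proof (induction k rule: inc_induct)
  case base
  have singleton: "(\<Sum>j=n..n. f j) = f n" for f :: "nat \<Rightarrow> complex"
    by simp
  \<comment> \<open>The only summand carries the inverse of the power of \<open>q\<close> in
    S[n+1,n+1] = q^(s n - (s-1) n) S[n,n], where S[n,n+1] = 0 was used.\<close>
  have "int s * int n * (int n - int n - 1) + (int s - 1) * int ((n + 1) choose 2)
      - (int s - 1) * int (n choose 2) = - (int s * int n - (int s - 1) * int n)"
    by (simp add: numeral_2_eq_2 algebra_simps)
  then show ?case
    unfolding singleton using assms(1) by (simp only:) (simp add: gstirling_eq_0 power_int_minus del: minus_diff_eq)
next
  case (step k)
  define b where "b i = qint q (int s * int n - (int s - 1) * int i)" for i
  define e where "e k j = int s * int n * (int k - int j - 1)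
    + (int s - 1) * int ((j + 1) choose 2) - (int s - 1) * int (k choose 2)" for k j
  define x where "x = int s * int n - (int s - 1) * int k"
  define T where "T k j = (- h) ^ (j - k) * q powi e k j * gstirling s h q (n + 1) (j + 1)
    * (\<Prod>i=k+1..j. b i)" for k j
  have e_diag: "e k k = - x"
    by (simp add: e_def x_def numeral_2_eq_2 algebra_simps)
  \<comment> \<open>Rests on (k+1 choose 2) = k + (k choose 2).\<close>
  have e_Suc: "e k j = - x + e (Suc k) j" for j
    by (simp add: e_def x_def numeral_2_eq_2 algebra_simps)
  have T_Suc: "T k j = q powi (- x) * (- h * b (Suc k)) * T (Suc k) j" if "Suc k \<le> j" for j
  proof -
    have "j - k = Suc (j - Suc k)" using that by simp
    moreover have "(\<Prod>i=k+1..j. b i) = b (Suc k) * (\<Prod>i=Suc k+1..j. b i)"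
      using that by (simp add: prod.atLeast_Suc_atMost)
    moreover have "q powi e k j = q powi (- x) * q powi e (Suc k) j"
      unfolding e_Suc using assms(1) by (intro power_int_add) simp
    ultimately show ?thesis unfolding T_def by (simp only: power_Suc mult_ac)
  qed
  have IH: "gstirling s h q n (Suc k) = (\<Sum>j=Suc k..n. T (Suc k) j)"
    using step.IH unfolding T_def e_def b_def .
  have rec: "gstirling s h q (Suc n) (Suc k)
      = q powi x * gstirling s h q n k + h * b (Suc k) * gstirling s h q n (Suc k)"
    by (simp add: x_def b_def)
  have "(\<Sum>j=k..n. T k j) = T k k + (\<Sum>j=Suc k..n. T k j)"
    using step.hyps by (simp add: sum.atLeast_Suc_atMost)
  also have "(\<Sum>j=Suc k..n. T k j)
      = q powi (- x) * (- h * b (Suc k)) * gstirling s h q n (Suc k)"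
    unfolding IH sum_distrib_left by (rule sum.cong) (simp_all add: T_Suc)
  also have "T k k = q powi (- x) * gstirling s h q (Suc n) (Suc k)"
    by (simp add: T_def e_diag del: gstirling.simps)
  \<comment> \<open>Inserting \<open>rec\<close> cancels the two terms with S[n,k+1].\<close>
  also have "q powi (- x) * gstirling s h q (Suc n) (Suc k)
      + q powi (- x) * (- h * b (Suc k)) * gstirling s h q n (Suc k)
      = (q powi (- x) * q powi x) * gstirling s h q n k"
    unfolding rec by (simp add: algebra_simps)
  also have "\<dots> = gstirling s h q n k"
    using assms(1) by (simp add: power_int_minus)
  finally show ?case unfolding T_def e_def b_def ..
qed

text \<open>The \<open>h\<close> term of the recurrence is the summand \<open>j = 0\<close>; the
  other term, in S[n-1,k-1], is expanded again. The difference n - k is preserved, so the descent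
  ends at \<open>k = 0\<close> with a positive upper index.\<close>

lemma gstirling_diagonal:
  assumes "q \<noteq> 0" "k < n"
  shows "gstirling s h q n k =
    (\<Sum>j=0..k. h
       * q powi (int j * (int s * int n - (int s - 1) * int k) - int ((j + 1) choose 2))
       * qint q (int s * (int n - int j - 1) - (int s - 1) * (int k - int j))
       * gstirling s h q (n - j - 1) (k - j))"
  using assms(2)
proof (induction k arbitrary: n)
  case 0
  \<comment> \<open>The left side is 0. On the right, S[n-1,0] vanishes unless \<open>n = 1\<close>,
    and then the q-integer is [0] = 0.\<close>
  then show ?case by (cases "n = 1") (auto simp: gstirling_0_right qint_0)
next
  case (Suc k)
  then obtain m where n: "n = Suc m" and "k < m" by (cases n) auto
  define e where "e n k j =
    int j * (int s * int n - (int s - 1) * int k) - int ((j + 1) choose 2)" for n k j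
  define T where "T n k j = h * q powi e n k j
    * qint q (int s * (int n - int j - 1) - (int s - 1) * (int k - int j))
    * gstirling s h q (n - j - 1) (k - j)" for n k j
  define x where "x = int s * int m - (int s - 1) * int k"
  have IH: "gstirling s h q m k = (\<Sum>j=0..k. T m k j)"
    using Suc.IH[OF \<open>k < m\<close>] unfolding T_def e_def .
  \<comment> \<open>A diagonal step changes s n - (s-1) k by exactly 1; the binomial absorbs the
    resulting j + 1.\<close>
  have e_Suc: "e (Suc m) (Suc k) (Suc j) = x + e m k j" for j
    by (simp add: e_def x_def numeral_2_eq_2 algebra_simps)
  have T_Suc: "T (Suc m) (Suc k) (Suc j) = q powi x * T m k j" for j
    using assms(1) unfolding T_def e_Suc by (simp add: power_int_add)
  have "(\<Sum>j=0..Suc k. T (Suc m) (Suc k) j)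
      = T (Suc m) (Suc k) 0 + q powi x * gstirling s h q m k"
    by (simp only: sum.atLeast0_atMost_Suc_shift o_def T_Suc IH sum_distrib_left)
  also have "\<dots> = gstirling s h q (Suc m) (Suc k)"
    by (simp add: T_def e_def x_def numeral_2_eq_2)
  finally show ?case unfolding n T_def e_def ..
qed

theorem corollary6:
  fixes s :: nat and h q :: complex
  assumes "h \<noteq> 0" and "q \<noteq> 0"
  shows "(\<forall>n k::nat. 1 \<le> k \<and> k \<le> n \<longrightarrow>
            gstirling s h q n k =
              (\<Sum>j=k..n. h ^ (n - j)
                 * q powi (int s * (int j - 1) - (int s - 1) * (int k - 1))
                 * gstirling s h q (j - 1) (k - 1)
                 * (\<Prod>i=j..<n. qint q (int s * int i - (int s - 1) * int k))))
       \<and> (\<forall>n k::nat. k \<le> n \<longrightarrow>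
            gstirling s h q n k =
              (\<Sum>j=k..n. (- h) ^ (j - k)
                 * q powi (int s * int n * (int k - int j - 1)
                           + (int s - 1) * int ((j + 1) choose 2)
                           - (int s - 1) * int (k choose 2))
                 * gstirling s h q (n + 1) (j + 1)
                 * (\<Prod>i=k+1..j. qint q (int s * int n - (int s - 1) * int i))))
       \<and> (\<forall>n k::nat. k < n \<longrightarrow>
            gstirling s h q n k =
              (\<Sum>j=0..k. h
                 * q powi (int j * (int s * int n - (int s - 1) * int k) - int ((j + 1) choose 2))
                 * qint q (int s * (int n - int j - 1) - (int s - 1) * (int k - int j))
                 * gstirling s h q (n - j - 1) (k - j)))"
proof (intro conjI allI impI)
  fix n k :: nat
  assume "1 \<le> k \<and> k \<le> n"
  then show "gstirling s h q n k =
      (\<Sum>j=k..n. h ^ (n - j)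
         * q powi (int s * (int j - 1) - (int s - 1) * (int k - 1))
         * gstirling s h q (j - 1) (k - 1)
         * (\<Prod>i=j..<n. qint q (int s * int i - (int s - 1) * int k)))"
    using gstirling_vertical[of k n s h q] by (simp only: mult.assoc)
qed (use gstirling_horizontal[OF assms(2)] gstirling_diagonal[OF assms(2)] in blast)+

end
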